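(* Let $\mathbf{p}_1,\mathbf{p}_2,\mathbf{p}_3\in\mathbb{R}^2$ be three non-collinear points, and let $\mathbf{q}_2=({q_2}_x,{q_2}_y)\in\mathbb{R}^2$ be the normalized image of $\mathbf{p}_2$ (defined in the context). For each $T\in(0,1)$ let $\mathbf{r}_T(t)=\mathbf{a}_1t^2+\mathbf{a}_2t+\mathbf{a}_3$ be the unique quadratic parametric curve with $\mathbf{r}_T(0)=\mathbf{p}_1$, $\mathbf{r}_T(T)=\mathbf{p}_2$ and $\mathbf{r}_T(1)=\mathbf{p}_3$, that is, $$\mathbf{a}_1=\frac{\mathbf{p}_2-\mathbf{p}_1-(\mathbf{p}_3-\mathbf{p}_1)T}{T^2-T},\qquad \mathbf{a}_2=\mathbf{p}_3-\mathbf{p}_1-\mathbf{a}_1,\qquad \mathbf{a}_3=\mathbf{p}_1 .$$ Then the cubic equation $$T^3-\tfrac32T^2+\bigl({q_2}_x-|\mathbf{q}_2|^2\bigr)T+\tfrac12|\mathbf{q}_2|^2=0$$ has three real roots, its middle root $T^*$ satisfies $0<T^*<1$, and $\mathbf{r}_{T^*}$ has the least energy among all the curves $\mathbf{r}_T$, $0<T<1$; that is, $E(\mathbf{r}_{T^*})\le E(\mathbf{r}_T)$ for every $T\in(0,1)$.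
   Context: $|\cdot|$ is the Euclidean norm on $\mathbb{R}^2$. Energy: for a quadratic parametric curve $\mathbf{r}(t)=(x(t),y(t))=\mathbf{a}_1t^2+\mathbf{a}_2t+\mathbf{a}_3$, $t\in\mathbb{R}$, with coefficients $\mathbf{a}_i\in\mathbb{R}^2$, the curvature is $$\kappa(t)=\frac{\dot x\ddot y-\dot y\ddot x}{(\dot x^2+\dot y^2)^{3/2}},$$ where dots are derivatives with respect to the parameter $t$, and the energy is $$E(\mathbf{r})=\int_{-\infty}^{\infty}\kappa(t)^2\,dt,$$ the integral being with respect to the curve parameter $t$ over the whole real line. Normalization: set $\widehat{\mathbf{p}}_i=(\mathbf{p}_i-\mathbf{p}_1)/|\mathbf{p}_3-\mathbf{p}_1|$ for $i=1,2,3$, write $\widehat{\mathbf{p}}_3=(u,v)$ (so $u^2+v^2=1$), let $A=\begin{pmatrix}u&v\\-v&u\end{pmatrix}$ be the rotation taking $\widehat{\mathbf{p}}_3$ to $(1,0)$, and put $\mathbf{q}_i=A\widehat{\mathbf{p}}_i$. Thus $\mathbf{q}_1=(0,0)$, $\mathbf{q}_3=(1,0)$ and $\mathbf{q}_2=({q_2}_x,{q_2}_y)$ with ${q_2}_y\neq0$. *)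

theory Defs
  imports "HOL-Analysis.Analysis"
begin

definition curvature :: "(real \<Rightarrow> real^2) \<Rightarrow> real \<Rightarrow> real" where
  "curvature r t =
     (let x = (\<lambda>s. r s $ 1); y = (\<lambda>s. r s $ 2);
          x' = deriv x; y' = deriv y
      in (x' t * deriv y' t - y' t * deriv x' t) / ((x' t)^2 + (y' t)^2) powr (3/2))"

text \<open>
  The integrand is nonnegative, so the integral is taken in \<^typ>\<open>ennreal\<close>; a divergent
  integral then has the value \<open>\<infinity>\<close>, whereas the Bochner integral would return \<open>0\<close>.
  Integration is with respect to the curve parameter, not arc length.
\<close>

definition energy :: "(real \<Rightarrow> real^2) \<Rightarrow> ennreal" where
  "energy r = (\<integral>\<^sup>+ t. ennreal ((curvature r t)^2) \<partial>lborel)"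

definition quad_curve :: "real^2 \<Rightarrow> real^2 \<Rightarrow> real^2 \<Rightarrow> real \<Rightarrow> real^2" where
  "quad_curve a1 a2 a3 t = t^2 *\<^sub>R a1 + t *\<^sub>R a2 + a3"

definition interp_curve :: "real^2 \<Rightarrow> real^2 \<Rightarrow> real^2 \<Rightarrow> real \<Rightarrow> real \<Rightarrow> real^2" where
  "interp_curve p1 p2 p3 T =
     (let a1 = (p2 - p1 - T *\<^sub>R (p3 - p1)) /\<^sub>R (T^2 - T);
          a2 = p3 - p1 - a1;
          a3 = p1
      in quad_curve a1 a2 a3)"

lemma interp_curve_unique:
  assumes "0 < T" "T < 1"
  shows "(\<exists>a1 a2 a3. r = quad_curve a1 a2 a3) \<and> r 0 = p1 \<and> r T = p2 \<and> r 1 = p3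
           \<longleftrightarrow> r = interp_curve p1 p2 p3 T"
proof
  have nz: "T^2 - T \<noteq> 0"
    using assms by (simp add: power2_eq_square)
  {
    assume "(\<exists>a1 a2 a3. r = quad_curve a1 a2 a3) \<and> r 0 = p1 \<and> r T = p2 \<and> r 1 = p3"
    then obtain a1 a2 a3 where r: "r = quad_curve a1 a2 a3"
      and *: "r 0 = p1" "r T = p2" "r 1 = p3" by blast
    have a3: "a3 = p1" and a2: "a2 = p3 - p1 - a1"
      using * by (auto simp: r quad_curve_def)
    have "(T^2 - T) *\<^sub>R a1 = p2 - p1 - T *\<^sub>R (p3 - p1)"
      using *(2) by (auto simp: r quad_curve_def a2 a3 algebra_simps)
    then have "a1 = (p2 - p1 - T *\<^sub>R (p3 - p1)) /\<^sub>R (T^2 - T)"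
      using nz by (metis inverse_scaleR_times scaleR_one scaleR_scaleR left_inverse)
    then show "r = interp_curve p1 p2 p3 T"
      by (simp add: interp_curve_def Let_def r a2 a3)
  next
    assume r: "r = interp_curve p1 p2 p3 T"
    define a1 where "a1 = (p2 - p1 - T *\<^sub>R (p3 - p1)) /\<^sub>R (T^2 - T)"
    have rq: "r = quad_curve a1 (p3 - p1 - a1) p1"
      by (simp add: r interp_curve_def a1_def Let_def)
    have "(T^2 - T) *\<^sub>R a1 = p2 - p1 - T *\<^sub>R (p3 - p1)"
      using nz by (simp add: a1_def)
    then have "r T = p2"
      by (simp add: rq quad_curve_def algebra_simps)
    moreover have "r 0 = p1" "r 1 = p3"
      by (simp_all add: rq quad_curve_def)
    ultimately show "(\<exists>a1 a2 a3. r = quad_curve a1 a2 a3) \<and> r 0 = p1 \<and> r T = p2 \<and> r 1 = p3"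
      using rq by blast
  }
qed

definition rotation_to_axis :: "real^2 \<Rightarrow> real^2^2" where
  "rotation_to_axis w = vector [vector [w$1, w$2], vector [- w$2, w$1]]"

definition normalized_point :: "real^2 \<Rightarrow> real^2 \<Rightarrow> real^2 \<Rightarrow> real^2" where
  "normalized_point p1 p3 p =
     (let hat = (\<lambda>z. (z - p1) /\<^sub>R norm (p3 - p1))
      in rotation_to_axis (hat p3) *v hat p)"

end

theory Submission
  imports Defs
begin

text \<open>
  For a quadratic curve, \<open>\<kappa>\<^sup>2 = 4D\<^sup>2 / |r'|\<^sup>6\<close> where \<open>D = a\<^sub>1 \<times> a\<^sub>2\<close> is constant and \<open>|r'|\<^sup>2\<close> is a
  quadratic polynomial in \<open>t\<close> with minimum \<open>D\<^sup>2/|a\<^sub>1|\<^sup>2\<close>. An affine change of the parameter gives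
  \<open>E = 2|a\<^sub>1|\<^sup>4/|D|\<^sup>3 \<cdot> I\<close> with the universal constant \<open>I = \<integral> (1 + s\<^sup>2)\<^sup>-\<^sup>3 ds\<close>, whose value is
  irrelevant. For the interpolating curve this is a constant multiple of \<open>g(T)\<^sup>2 / (T(1 - T))\<close> with
  \<open>g(T) = |q\<^sub>2 - T e\<^sub>1|\<^sup>2\<close>, and the sign of its derivative is opposite to that of the cubic.
\<close>

section \<open>Energy of quadratic and interpolating curves\<close>

definition cross2 :: "real^2 \<Rightarrow> real^2 \<Rightarrow> real" where
  "cross2 a b = a$1 * b$2 - a$2 * b$1"

lemma norm2_sq: "(norm (a::real^2))\<^sup>2 = (a$1)\<^sup>2 + (a$2)\<^sup>2"
  by (simp only: power2_norm_eq_inner) (simp add: inner_vec_def sum_2 power2_eq_square)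

lemma curvature_quad_curve:
  "(curvature (quad_curve a1 a2 a3) t)\<^sup>2
     = 4 * (cross2 a1 a2)\<^sup>2 / ((norm ((2 * t) *\<^sub>R a1 + a2))\<^sup>2) ^ 3"
proof -
  have d1: "deriv (\<lambda>s. quad_curve a1 a2 a3 s $ i) = (\<lambda>s. 2 * s * a1$i + a2$i)" for i
    by (rule ext, rule DERIV_imp_deriv)
       (auto simp: quad_curve_def intro!: derivative_eq_intros)
  have d2: "deriv (\<lambda>s. 2 * s * a1$i + a2$i) t = 2 * a1$i" for i
    by (rule DERIV_imp_deriv) (auto intro!: derivative_eq_intros)
  define z where "z = (norm ((2 * t) *\<^sub>R a1 + a2))\<^sup>2"
  have z: "(2 * t * a1$1 + a2$1)\<^sup>2 + (2 * t * a1$2 + a2$2)\<^sup>2 = z"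
    by (simp add: z_def norm2_sq)
  \<comment> \<open>Where the velocity vanishes both sides are 0, because
    \<open>0 powr (3/2) = 0\<close>.\<close>
  have "(z powr (3/2))\<^sup>2 = z ^ 3"
  proof (cases "z = 0")
    case False
    then have "z > 0" by (simp add: z_def)
    then show ?thesis
      by (simp add: powr_power powr_numeral)
  qed simp
  moreover have "(2 * t * a1$1 + a2$1) * (2 * a1$2) - (2 * t * a1$2 + a2$2) * (2 * a1$1)
                   = - 2 * cross2 a1 a2"
    by (simp add: cross2_def algebra_simps)
  ultimately show ?thesis
    unfolding curvature_def Let_def d1 d2 z z_def[symmetric]
    by (simp add: power_divide power_mult_distrib)
qed

lemma energy_quad_curve:
  assumes "cross2 a1 a2 \<noteq> 0"
  shows "energy (quad_curve a1 a2 a3)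
    = ennreal (2 * (norm a1)^4 / \<bar>cross2 a1 a2\<bar>^3) * (\<integral>\<^sup>+ s. ennreal (1 / (1 + s\<^sup>2)^3) \<partial>lborel)"
proof -
  define D where "D = \<bar>cross2 a1 a2\<bar>"
  define A where "A = (norm a1)\<^sup>2"
  \<comment> \<open>Completing the square: \<open>t0\<close> is the parameter of least speed, where
    the velocity is orthogonal to \<open>a1\<close>. The scale \<open>c\<close> turns the squared
    speed into a multiple of \<open>1 + s\<^sup>2\<close>; by Lagrange's identity the constant left
    over is \<open>D\<^sup>2 / A\<close>.\<close>
  define c where "c = D / (2 * A)"
  define t0 where "t0 = - (a1 \<bullet> a2) / (2 * A)"
  have "a1 \<noteq> 0" using assms by (auto simp: cross2_def)
  then have A: "A > 0" by (simp add: A_def)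
  have D: "D > 0" using assms by (simp add: D_def)
  have c: "c > 0" using A D by (simp add: c_def)
  have lagrange: "A * (norm a2)\<^sup>2 = (a1 \<bullet> a2)\<^sup>2 + D\<^sup>2"
    by (simp add: A_def D_def norm2_sq cross2_def inner_vec_def sum_2) algebra
  have speed: "(norm ((2 * (t0 + c * s)) *\<^sub>R a1 + a2))\<^sup>2 = D\<^sup>2 / A * (1 + s\<^sup>2)" for s
  proof -
    have "A * (norm ((2 * (t0 + c * s)) *\<^sub>R a1 + a2))\<^sup>2
        = (2 * A * (t0 + c * s) + a1 \<bullet> a2)\<^sup>2 + D\<^sup>2"
    proof -
      have "A * (norm (x *\<^sub>R a1 + a2))\<^sup>2 = (A * x + a1 \<bullet> a2)\<^sup>2 + D\<^sup>2" for x
      proof -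
        have "(norm (x *\<^sub>R a1 + a2))\<^sup>2 = x\<^sup>2 * A + 2 * x * (a1 \<bullet> a2) + (norm a2)\<^sup>2"
          unfolding A_def power2_norm_eq_inner
          by (simp add: inner_add inner_commute power2_eq_square)
        then show ?thesis using lagrange by (simp add: algebra_simps power2_eq_square)
      qed
      moreover have "A * (2 * x) = 2 * A * x" for x by simp
      ultimately show ?thesis by (simp only:)
    qed
    also have "2 * A * (t0 + c * s) + a1 \<bullet> a2 = D * s"
      using A by (simp add: t0_def c_def field_simps)
    finally show ?thesis using A by (simp add: field_simps power_mult_distrib)
  qed
  have integrand: "(curvature (quad_curve a1 a2 a3) (t0 + c * s))\<^sup>2
      = 4 * A^3 / D^4 * (1 / (1 + s\<^sup>2)^3)" for s
  proof -
    have "(curvature (quad_curve a1 a2 a3) (t0 + c * s))\<^sup>2 = 4 * D\<^sup>2 / (D\<^sup>2 / A * (1 + s\<^sup>2))^3"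
      by (simp only: curvature_quad_curve speed) (simp add: D_def)
    also have "4 * D\<^sup>2 / (D\<^sup>2 / A * w)^3 = 4 * A^3 / D^4 * (1 / w^3)" for w
      using A D by (cases "w = 0") (simp_all add: field_simps eval_nat_numeral)
    finally show ?thesis .
  qed
  have meas: "(\<lambda>t. ennreal ((curvature (quad_curve a1 a2 a3) t)\<^sup>2)) \<in> borel_measurable borel"
    unfolding curvature_quad_curve by measurable
  have "energy (quad_curve a1 a2 a3)
      = ennreal c * (\<integral>\<^sup>+ s. ennreal ((curvature (quad_curve a1 a2 a3) (t0 + c * s))\<^sup>2) \<partial>lborel)"
    unfolding energy_def using nn_integral_real_affine[OF meas, of c t0] c by simp
  also have "\<dots> = ennreal c * (ennreal (4 * A^3 / D^4)
                     * (\<integral>\<^sup>+ s. ennreal (1 / (1 + s\<^sup>2)^3) \<partial>lborel))"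
  proof -
    have "ennreal (4 * A^3 / D^4 * (1 / (1 + s\<^sup>2)^3))
        = ennreal (4 * A^3 / D^4) * ennreal (1 / (1 + s\<^sup>2)^3)" for s
      using A D by (intro ennreal_mult) simp_all
    then show ?thesis
      unfolding integrand by (simp only:) (subst nn_integral_cmult, measurable)
  qed
  also have "\<dots> = ennreal (c * (4 * A^3 / D^4)) * (\<integral>\<^sup>+ s. ennreal (1 / (1 + s\<^sup>2)^3) \<partial>lborel)"
    using A D c by (subst ennreal_mult) (simp_all add: mult.assoc)
  also have "c * (4 * A^3 / D^4) = 2 * (norm a1)^4 / D^3"
  proof -
    have n4: "(norm a1)^4 = A\<^sup>2" by (simp add: A_def flip: power_mult)
    show ?thesis unfolding n4 using A D
      by (simp add: c_def field_simps eval_nat_numeral)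
  qed
  finally show ?thesis by (simp add: D_def)
qed

text \<open>Write \<open>b = p2 - p1 - T *\<^sub>R (p3 - p1)\<close> and
  \<open>w = T * (1 - T)\<close>, so that \<open>a1\<close> is \<open>b\<close> divided by
  \<open>-w\<close>. Subtracting multiples of one argument from the other leaves a cross product
  unchanged, hence \<open>cross2 a1 a2 = -K / w\<close>. In the quotient of the fourth power of
  \<open>norm a1\<close> by the cube of this determinant a single \<open>w\<close> survives in the
  denominator.\<close>

lemma energy_interp_curve:
  fixes p1 p2 p3 :: "real^2"
  defines "K \<equiv> cross2 (p2 - p1) (p3 - p1)"
  assumes K: "K \<noteq> 0" and T: "0 < T" "T < 1"
  shows "energy (interp_curve p1 p2 p3 T)
    = ennreal (2 / \<bar>K\<bar>^3 * ((norm (p2 - p1 - T *\<^sub>R (p3 - p1)))^4 / (T * (1 - T))))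
        * (\<integral>\<^sup>+ s. ennreal (1 / (1 + s\<^sup>2)^3) \<partial>lborel)"
proof -
  define w where "w = T * (1 - T)"
  define b where "b = p2 - p1 - T *\<^sub>R (p3 - p1)"
  define a1 where "a1 = b /\<^sub>R (T\<^sup>2 - T)"
  have w: "w > 0" and w': "T\<^sup>2 - T = - w"
    using T by (simp_all add: w_def power2_eq_square algebra_simps)
  have D: "cross2 a1 (p3 - p1 - a1) = - K / w"
    unfolding a1_def w' b_def K_def cross2_def
    using w by (simp add: field_simps)
  have "energy (interp_curve p1 p2 p3 T) = energy (quad_curve a1 (p3 - p1 - a1) p1)"
    by (simp add: interp_curve_def Let_def a1_def b_def)
  also have "\<dots> = ennreal (2 * (norm a1)^4 / (\<bar>K\<bar> / w)^3)
                   * (\<integral>\<^sup>+ s. ennreal (1 / (1 + s\<^sup>2)^3) \<partial>lborel)"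
    using energy_quad_curve[of a1 "p3 - p1 - a1" p1] D K w by simp
  also have "2 * (norm a1)^4 / (\<bar>K\<bar> / w)^3 = 2 / \<bar>K\<bar>^3 * ((norm b)^4 / w)"
  proof -
    have "norm b = w * norm a1" using w by (simp add: a1_def w')
    then show ?thesis using w K by (simp add: field_simps eval_nat_numeral)
  qed
  finally show ?thesis by (simp add: w_def b_def)
qed

section \<open>Normalized coordinates and collinearity\<close>

lemma normalized_point_inner:
  assumes "p1 \<noteq> p3"
  shows "normalized_point p1 p3 p $ 1 = (p - p1) \<bullet> (p3 - p1) / (norm (p3 - p1))\<^sup>2"
    and "normalized_point p1 p3 p $ 2 = - cross2 (p - p1) (p3 - p1) / (norm (p3 - p1))\<^sup>2"
    and "(norm (normalized_point p1 p3 p))\<^sup>2 = (norm (p - p1))\<^sup>2 / (norm (p3 - p1))\<^sup>2"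
proof -
  define P Q L where defs: "P = p - p1" "Q = p3 - p1" "L = norm Q"
  have L: "L > 0" using assms by (simp add: defs)
  have L2: "L\<^sup>2 = (Q$1)\<^sup>2 + (Q$2)\<^sup>2" by (simp add: defs norm2_sq)
  let ?q = "normalized_point p1 p3 p"
  \<comment> \<open>In complex notation the normalization is division of \<open>P\<close> by
    \<open>Q\<close>: the coordinates are the real and imaginary parts of P times the conjugate of
    Q, over \<open>L\<^sup>2\<close>. The minus sign comes from the order of the arguments of
    \<open>cross2\<close>.\<close>
  have q: "?q $ 1 = (P \<bullet> Q) / L\<^sup>2" "?q $ 2 = - cross2 P Q / L\<^sup>2"
    using L unfolding normalized_point_def rotation_to_axis_def Let_def defs[symmetric]
    by (simp_all add: matrix_vector_mult_def sum_2 inner_vec_def cross2_def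
        power2_eq_square field_simps)
  show "?q $ 1 = (p - p1) \<bullet> (p3 - p1) / (norm (p3 - p1))\<^sup>2"
       "?q $ 2 = - cross2 (p - p1) (p3 - p1) / (norm (p3 - p1))\<^sup>2"
    using q by (simp_all add: defs)
  have "(P \<bullet> Q)\<^sup>2 + (cross2 P Q)\<^sup>2 = (norm P)\<^sup>2 * L\<^sup>2"
    by (simp add: L2 norm2_sq[of P] cross2_def inner_vec_def sum_2) algebra
  then have "(norm ?q)\<^sup>2 = (norm P)\<^sup>2 * L\<^sup>2 / (L\<^sup>2)\<^sup>2"
    by (simp add: norm2_sq[of ?q] q power_divide flip: add_divide_distrib)
  then show "(norm ?q)\<^sup>2 = (norm (p - p1))\<^sup>2 / (norm (p3 - p1))\<^sup>2"
    using L by (simp add: defs power2_eq_square)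
qed

text \<open>A zero cross product makes \<open>P\<close> equal to its own orthogonal projection onto
  \<open>Q\<close>, hence a multiple of \<open>Q\<close>. The projection divides by
  \<open>Q \<bullet> Q\<close>, so coinciding endpoints are a separate case.\<close>

lemma collinear_if_cross2_zero:
  assumes "cross2 (p2 - p1) (p3 - p1) = 0"
  shows "collinear {p1, p2, p3}"
proof (cases "p3 = p1")
  case True
  then show ?thesis by (simp add: insert_commute)
next
  case False
  define P Q where defs: "P = p2 - p1" "Q = p3 - p1"
  have "Q \<noteq> 0" using False by (simp add: defs)
  then have nz: "Q \<bullet> Q \<noteq> 0" by simp
  have "(Q \<bullet> Q) *\<^sub>R P = (P \<bullet> Q) *\<^sub>R Q"
  proof -
    have c: "P$1 * Q$2 = P$2 * Q$1" using assms by (simp add: defs cross2_def)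
    show ?thesis unfolding vec_eq_iff forall_2
      by (simp add: inner_vec_def sum_2) (use c in algebra)
  qed
  then have "inverse (Q \<bullet> Q) *\<^sub>R (Q \<bullet> Q) *\<^sub>R P = inverse (Q \<bullet> Q) *\<^sub>R (P \<bullet> Q) *\<^sub>R Q"
    by simp
  then have "P = (inverse (Q \<bullet> Q) * (P \<bullet> Q)) *\<^sub>R Q"
    using nz by (simp only: scaleR_scaleR left_inverse scaleR_one if_True not_False_eq_True)
  then have "collinear {0, Q, P}"
    unfolding collinear_lemma by blast
  moreover have "collinear {p2, p1, p3} \<longleftrightarrow> collinear {0, P, Q}"
    unfolding defs by (rule collinear_3) (simp only: NO_MATCH_def)
  ultimately show ?thesis by (simp add: insert_commute)
qed

section \<open>Roots of the cubic\<close>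

lemma monic_cubic_factor:
  fixes a b c :: real
  assumes "a \<noteq> b" "a \<noteq> c" "b \<noteq> c"
    and "\<And>x. p x = x^3 + \<alpha> * x\<^sup>2 + \<beta> * x + \<gamma>"
    and "p a = 0" "p b = 0" "p c = 0"
  shows "p x = (x - a) * (x - b) * (x - c)"
proof -
  \<comment> \<open>Divided differences: subtracting the equations for two roots and cancelling
    their nonzero difference lowers the degree. Doing this twice gives the sum of the roots, then
    the other Vieta formulas.\<close>
  have "(a - b) * (a\<^sup>2 + a*b + b\<^sup>2 + \<alpha> * (a + b) + \<beta>) = 0"
    using assms(4)[of a] assms(4)[of b] assms(5,6) by algebra
  then have 1: "a\<^sup>2 + a*b + b\<^sup>2 + \<alpha> * (a + b) + \<beta> = 0" using assms by simp
  have "(a - c) * (a\<^sup>2 + a*c + c\<^sup>2 + \<alpha> * (a + c) + \<beta>) = 0"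
    using assms(4)[of a] assms(4)[of c] assms(5,7) by algebra
  then have 2: "a\<^sup>2 + a*c + c\<^sup>2 + \<alpha> * (a + c) + \<beta> = 0" using assms by simp
  have "(b - c) * (a + b + c + \<alpha>) = 0" using 1 2 by algebra
  then have \<alpha>: "\<alpha> = - (a + b + c)" using assms by simp
  have \<beta>: "\<beta> = a*b + a*c + b*c" using 1 \<alpha> by algebra
  have "\<gamma> = - a*b*c" using assms(4)[of a] assms(5) \<alpha> \<beta> by algebra
  then show ?thesis unfolding assms(4) \<alpha> \<beta> by algebra
qed

text \<open>The signs of \<open>p\<close> far to the left, at 0, at 1 and far to the right are -, +,
  -, +, and the intermediate value theorem gives a root in each gap. For m and n taken from q2,
  \<open>p 0\<close> is half the squared distance of q2 from the origin, and \<open>p 1\<close> is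
  minus half that from (1,0).\<close>

lemma cubic_three_roots:
  fixes m n :: real
  defines "p \<equiv> \<lambda>T. T^3 - 3/2 * T\<^sup>2 + (m - n) * T + 1/2 * n"
  assumes mn: "m\<^sup>2 < n"
  obtains T1 Ts T3 where "T1 < 0" "0 < Ts" "Ts < 1" "1 < T3"
    "\<And>T. p T = (T - T1) * (T - Ts) * (T - T3)"
proof -
  have cont: "continuous_on S p" for S unfolding p_def by (intro continuous_intros)
  have n: "n > 0" using mn by (smt (verit) zero_le_power2)
  have p0: "p 0 > 0" using n by (simp add: p_def)
  have "2 * p 1 = - ((1 - m)\<^sup>2 + (n - m\<^sup>2))" by (simp add: p_def power2_eq_square algebra_simps)
  then have p1: "p 1 < 0" using mn by (smt (verit) zero_le_power2)
  \<comment> \<open>Large enough that \<open>y\<^sup>2 + (m - n) \<ge> 1 + n\<close>, so the product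
    with \<open>y\<close> outweighs the term \<open>1/2 * n\<close> in
    \<open>p (- y)\<close>.\<close>
  define y where "y = 1 + \<bar>m - n\<bar> + n"
  have y: "y \<ge> 1" using n by (simp add: y_def)
  have py: "p (- y) < 0"
  proof -
    have "y\<^sup>2 \<ge> y" using y by (simp add: power2_eq_square)
    then have "y\<^sup>2 + (m - n) \<ge> 1 + n" by (simp add: y_def)
    then have X: "y * (y\<^sup>2 + (m - n)) \<ge> 1 * (1 + n)" (is "?X \<ge> _")
      using y n by (intro mult_mono) auto
    have "p (- y) = - ?X - 3/2 * y\<^sup>2 + 1/2 * n"
      by (simp add: p_def power2_eq_square power3_eq_cube algebra_simps)
    also have "\<dots> \<le> - ?X + 1/2 * n" by simp
    also have "\<dots> \<le> - (1 + n) + 1/2 * n" using X by simp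
    also have "\<dots> < 0" using n by simp
    finally show ?thesis .
  qed
  \<comment> \<open>Large enough that \<open>z - 3/2 \<ge> 1/2\<close> and that
    \<open>z * (1/2)\<close> exceeds the absolute value of \<open>m - n\<close>, which makes the
    nested form of \<open>p z\<close> positive.\<close>
  define z where "z = 2 + 2 * \<bar>m - n\<bar>"
  have z: "z \<ge> 2" by (simp add: z_def)
  have pz: "p z > 0"
  proof -
    have "z * (z - 3/2) \<ge> z * (1/2)" using z by (intro mult_left_mono) auto
    moreover have "z * (1/2) = 1 + \<bar>m - n\<bar>" by (simp add: z_def)
    ultimately have "z * (z - 3/2) + (m - n) \<ge> 0" by linarith
    then have "z * (z * (z - 3/2) + (m - n)) \<ge> 0" using z by simp
    moreover have "p z = z * (z * (z - 3/2) + (m - n)) + 1/2 * n"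
      by (simp add: p_def power2_eq_square power3_eq_cube algebra_simps)
    ultimately show ?thesis using n by simp
  qed
  obtain T1 where T1: "- y \<le> T1" "T1 \<le> 0" "p T1 = 0"
    using IVT'[of p "- y" 0 0] py p0 y cont by auto
  obtain Ts where Ts: "0 \<le> Ts" "Ts \<le> 1" "p Ts = 0"
    using IVT2'[of p 1 0 0] p1 p0 cont by auto
  obtain T3 where T3: "1 \<le> T3" "T3 \<le> z" "p T3 = 0"
    using IVT'[of p 1 0 z] p1 pz z cont by auto
  have strict: "T1 < 0" "0 < Ts" "Ts < 1" "1 < T3"
    using T1 Ts T3 p0 p1 by (auto simp: order_less_le)
  have "p T = (T - T1) * (T - Ts) * (T - T3)" for T
    by (rule monic_cubic_factor[where \<alpha> = "- 3/2" and \<beta> = "m - n" and \<gamma> = "1/2 * n"])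
       (use strict T1 Ts T3 in \<open>auto simp: p_def\<close>)
  with strict show ?thesis using that by blast
qed

section \<open>Minimization over the open unit interval\<close>

lemma quartic_ratio_min:
  fixes m n T1 Ts T3 T :: real
  defines "f \<equiv> \<lambda>T. (T\<^sup>2 - 2 * m * T + n)\<^sup>2 / (T * (1 - T))"
  assumes mn: "m\<^sup>2 < n"
    and ord: "T1 < 0" "0 < Ts" "Ts < 1" "1 < T3"
    and fac: "\<And>T. T^3 - 3/2 * T\<^sup>2 + (m - n) * T + 1/2 * n = (T - T1) * (T - Ts) * (T - T3)"
    and T: "0 < T" "T < 1"
  shows "f Ts \<le> f T"
proof -
  \<comment> \<open>For m and n taken from q2, \<open>g T\<close> is the squared distance from q2 to
    the point (T,0); it is positive because q2 lies off the axis.\<close>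
  define g where "g T = T\<^sup>2 - 2 * m * T + n" for T
  define f' where "f' x = - 2 * g x * ((x - T1) * (x - Ts) * (x - T3)) / (x * (1 - x))\<^sup>2" for x
  have g: "g x > 0" for x
  proof -
    have "g x = (x - m)\<^sup>2 + (n - m\<^sup>2)" by (simp add: g_def power2_eq_square algebra_simps)
    then show ?thesis using mn by (smt (verit) zero_le_power2)
  qed
  have deriv: "(f has_real_derivative f' x) (at x)" if "0 < x" "x < 1" for x
  proof -
    have "(f has_real_derivative
        (2 * g x * (2 * x - 2 * m) * (x * (1 - x)) - (g x)\<^sup>2 * (1 - 2 * x)) / (x * (1 - x))\<^sup>2) (at x)"
      unfolding f_def g_def using that
      by (auto intro!: derivative_eq_intros simp: power2_eq_square)
    \<comment> \<open>The cubic arises here: once a factor \<open>g x\<close> is taken out of the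
      numerator of the quotient rule, what remains is -2 times the cubic.\<close>
    moreover have "2 * g x * (2 * x - 2 * m) * (x * (1 - x)) - (g x)\<^sup>2 * (1 - 2 * x)
        = - 2 * g x * ((x - T1) * (x - Ts) * (x - T3))"
      unfolding fac[symmetric] g_def by algebra
    ultimately show ?thesis by (simp add: f'_def)
  qed
  \<comment> \<open>As \<open>T1 < 0\<close> and \<open>1 < T3\<close>, only the factor
    \<open>x - Ts\<close> changes sign on the open unit interval, so \<open>f\<close> falls up to
    \<open>Ts\<close> and rises after it.\<close>
  have sign: "f' x \<le> 0" if "0 < x" "x \<le> Ts" for x
    using that ord g[of x] unfolding f'_def
    by (intro divide_nonpos_nonneg mult_nonpos_nonneg mult_nonneg_nonneg mult_nonneg_nonpos
        mult_nonpos_nonpos) auto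
  have sign': "f' x \<ge> 0" if "Ts \<le> x" "x < 1" for x
  proof -
    have "(x - T1) * (x - Ts) * (x - T3) \<le> 0"
      using that ord by (intro mult_nonneg_nonpos mult_nonneg_nonneg) auto
    then show ?thesis using g[of x] unfolding f'_def
      by (intro divide_nonneg_nonneg mult_nonpos_nonpos) auto
  qed
  show ?thesis
  proof (cases "T \<le> Ts")
    case True
    have "\<exists>d. (f has_real_derivative d) (at x) \<and> d \<le> 0" if "T \<le> x" "x \<le> Ts" for x
      using deriv[of x] sign[of x] T ord that by (intro exI[of _ "f' x"]) simp
    then show ?thesis by (rule DERIV_nonpos_imp_nonincreasing[OF True])
  next
    case False
    then have le: "Ts \<le> T" by simp
    have "\<exists>d. (f has_real_derivative d) (at x) \<and> 0 \<le> d" if "Ts \<le> x" "x \<le> T" for x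
      using deriv[of x] sign'[of x] T ord that by (intro exI[of _ "f' x"]) simp
    then show ?thesis by (rule DERIV_nonneg_imp_nondecreasing[OF le])
  qed
qed

theorem mainTheorem1:
  fixes p1 p2 p3 q2 :: "real^2"
  assumes "\<not> collinear {p1, p2, p3}"
    and "q2 = normalized_point p1 p3 p2"
  shows "\<exists>T1 Ts T3 :: real. T1 < Ts \<and> Ts < T3
    \<and> {T :: real. T^3 - 3/2 * T^2 + (q2$1 - (norm q2)^2) * T + 1/2 * (norm q2)^2 = 0} = {T1, Ts, T3}
    \<and> 0 < Ts \<and> Ts < 1
    \<and> (\<forall>T. 0 < T \<and> T < 1 \<longrightarrow>
          energy (interp_curve p1 p2 p3 Ts) \<le> energy (interp_curve p1 p2 p3 T))"
proof -
  define K where "K = cross2 (p2 - p1) (p3 - p1)"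
  define L where "L = norm (p3 - p1)"
  define m n where "m = q2$1" and "n = (norm q2)\<^sup>2"
  have K: "K \<noteq> 0" using assms(1) collinear_if_cross2_zero unfolding K_def by blast
  have ne: "p1 \<noteq> p3" using K by (auto simp: K_def cross2_def)
  then have L: "L > 0" by (simp add: L_def)
  note q = normalized_point_inner[OF ne, of p2, folded assms(2) K_def L_def]
  \<comment> \<open>The difference \<open>n - m\<^sup>2\<close> is the square of
    \<open>q2$2\<close>; this is how non-collinearity reaches the cubic.\<close>
  have "q2$2 \<noteq> 0" using q(2) K L by simp
  then have mn: "m\<^sup>2 < n" by (simp add: m_def n_def norm2_sq)
  \<comment> \<open>The normalization is a similarity of ratio \<open>1 / L\<close>, which accounts
    for the factor \<open>L^4\<close>.\<close>
  have dist: "(norm (p2 - p1 - T *\<^sub>R (p3 - p1)))^4 = L^4 * (T\<^sup>2 - 2 * m * T + n)\<^sup>2" for T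
  proof -
    have "(norm (p2 - p1 - T *\<^sub>R (p3 - p1)))\<^sup>2
        = (norm (p2 - p1))\<^sup>2 - 2 * T * ((p2 - p1) \<bullet> (p3 - p1)) + T\<^sup>2 * L\<^sup>2"
      unfolding L_def power2_norm_eq_inner
      by (simp only: inner_diff_left inner_diff_right inner_scaleR_left inner_scaleR_right
          inner_commute power2_eq_square)
    also have "\<dots> = L\<^sup>2 * (T\<^sup>2 - 2 * m * T + n)"
      using q(1,3) L by (simp add: m_def n_def field_simps)
    finally have "((norm (p2 - p1 - T *\<^sub>R (p3 - p1)))\<^sup>2)\<^sup>2 = (L\<^sup>2 * (T\<^sup>2 - 2 * m * T + n))\<^sup>2"
      by simp
    then show ?thesis by (simp add: power_mult_distrib flip: power_mult)
  qed
  obtain T1 Ts T3 where ord: "T1 < 0" "0 < Ts" "Ts < 1" "1 < T3"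
    and fac: "\<And>T. T^3 - 3/2 * T\<^sup>2 + (m - n) * T + 1/2 * n = (T - T1) * (T - Ts) * (T - T3)"
    using cubic_three_roots[OF mn] by blast
  have "energy (interp_curve p1 p2 p3 Ts) \<le> energy (interp_curve p1 p2 p3 T)"
    if T: "0 < T" "T < 1" for T
  proof -
    have "L^4 * (Ts\<^sup>2 - 2 * m * Ts + n)\<^sup>2 / (Ts * (1 - Ts))
        \<le> L^4 * (T\<^sup>2 - 2 * m * T + n)\<^sup>2 / (T * (1 - T))"
      using mult_left_mono[OF quartic_ratio_min[OF mn ord fac T], of "L^4"] L by simp
    \<comment> \<open>Both energies are the same \<open>ennreal\<close> integral times a real
      coefficient. Multiplication by a fixed \<open>ennreal\<close> is monotone, so comparing the
      coefficients suffices.\<close>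
    then show ?thesis
      unfolding energy_interp_curve[OF K[unfolded K_def] ord(2,3)]
        energy_interp_curve[OF K[unfolded K_def] T] dist
      by (intro mult_right_mono ennreal_leI mult_left_mono) auto
  qed
  moreover have "{T. T^3 - 3/2 * T\<^sup>2 + (m - n) * T + 1/2 * n = 0} = {T1, Ts, T3}"
    unfolding fac by auto
  ultimately show ?thesis
    using ord unfolding m_def n_def by (intro exI[of _ T1] exI[of _ Ts] exI[of _ T3]) auto
qed

end
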